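(* Let $T$ and $T'$ be finite vertex-colored arborescences with vertex-colored Prüfer codes (VCPCs) $P$ and $P'$. There exists a vertex-colored isomorphism between $T$ and $T'$ if and only if $P=P'$.
   Context: A vertex-colored arborescence is a finite directed tree $T$ with a root $r$ such that every edge is directed away from $r$, together with a coloring $c:V(T)\to\mathbb{N}$ (not necessarily proper). A vertex-colored isomorphism is a bijection of vertex sets that maps directed edges exactly onto directed edges and preserves colors. For $v\in V(T)$, $T[v]$ is the subarborescence of $v$ and all its descendants. Arrays are compared lexicographically: $x<y$ iff there is an index $i$ with $x[j]=y[j]$ for all $j<i$ and either $x[i]<y[i]$ (entries being integers or arrays compared recursively), or $x$ has length $i$ while $y$ is longer. The array $\mathrm{L}\mathcal{D}_A$ is defined recursively: if $u$ has no children, $\mathrm{L}\mathcal{D}_A(T[u])=[[\,]]$; otherwise, list the children of $u$ as $n_1,\dots,n_k$ sorted so that $n_a$ precedes $n_b$ whenever $c(n_a)<c(n_b)$, or $c(n_a)=c(n_b)$ and $\mathrm{L}\mathcal{D}_A(T[n_a])<\mathrm{L}\mathcal{D}_A(T[n_b])$ (remaining ties broken arbitrarily), and set $\mathrm{L}\mathcal{D}_A(T[u])=[[c(n_1),\dots,c(n_k)]]+\mathrm{L}\mathcal{D}_A(T[n_1])+\cdots+\mathrm{L}\mathcal{D}_A(T[n_k])$ ($+$ is concatenation). Let $\phi:V(T)\to\{0,\dots,n-1\}$ ($n=|V(T)|$) assign to each vertex its position in the preorder depth-first traversal from the root in which the children of every vertex are visited in this sorted order. The VCPC of $T$ is the $2\times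 n$ array built as follows: for steps $i=0,\dots,n-2$, in the current tree remove the vertex of out-degree zero with smallest $\phi$-value, recording in column $i$ the value $\phi$ of its parent (first row) and its color (second row); in the last column $n-1$ record $\emptyset$ in the first row and the color of the root in the second row. *)

theory Defs
  imports
    "Graph_Theory.Graph_Theory"
    "HOL-Library.List_Lexorder"
    "HOL-Library.Product_Lexorder"
begin

text \<open>
  The library constant \<open>tree\<close> only forbids directed cycles, so it also admits, e.g., directed
  acyclic graphs with two internally disjoint paths between the same endpoints. Here a directed graph
  is a tree if its underlying undirected graph is one: any two vertices are joined by exactly one
  simple path of the symmetric closure.
\<close>
definition underlying_tree :: "'a pair_pre_digraph \<Rightarrow> bool" where
  "underlying_tree T \<longleftrightarrow> pverts T \<noteq> {} \<and>
     (\<forall>u \<in> pverts T. \<forall>v \<in> pverts T. \<exists>!p. pre_digraph.apath (mk_symmetric T) u p v)"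

text \<open>
  In \<open>directed_away\<close>, the edge \<open>(u, v)\<close> points away from \<open>r\<close> if the path from \<open>r\<close> to \<open>v\<close> in the
  underlying undirected tree traverses it last, from \<open>u\<close> to \<open>v\<close>. The coloring \<open>c\<close> is a total
  function, of which only the values on the vertices are ever used.
\<close>
locale colored_arborescence = pair_digraph T
  for T :: "'a pair_pre_digraph" +
  fixes r :: 'a and c :: "'a \<Rightarrow> nat"
  assumes tree: "underlying_tree T"
    and root: "r \<in> pverts T"
    and directed_away:
      "(u, v) \<in> parcs T \<Longrightarrow> \<exists>p. pre_digraph.apath (mk_symmetric T) r (p @ [(u, v)]) v"

definition children :: "'a pair_pre_digraph \<Rightarrow> 'a \<Rightarrow> 'a set" where
  "children T u = {v. (u, v) \<in> parcs T}"

definition parent :: "('a, 'b) pre_digraph \<Rightarrow> 'a \<Rightarrow> 'a" where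
  "parent G v = (THE u. u \<rightarrow>\<^bsub>G\<^esub> v)"

definition colored_iso ::
  "'a pair_pre_digraph \<Rightarrow> ('a \<Rightarrow> nat) \<Rightarrow> 'b pair_pre_digraph \<Rightarrow> ('b \<Rightarrow> nat) \<Rightarrow> ('a \<Rightarrow> 'b) \<Rightarrow> bool" where
  "colored_iso T c T' c' f \<longleftrightarrow>
     bij_betw f (pverts T) (pverts T') \<and>
     (\<forall>u \<in> pverts T. \<forall>v \<in> pverts T. (u, v) \<in> parcs T \<longleftrightarrow> (f u, f v) \<in> parcs T') \<and>
     (\<forall>v \<in> pverts T. c' (f v) = c v)"

context colored_arborescence
begin

lemma wf_underlying: "wf_digraph (with_proj (mk_symmetric T))"
  unfolding wf_digraph_wp_iff
  by unfold_locales (auto simp: mk_symmetric_def dest: arc_fst_in_verts arc_snd_in_verts)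

lemma wf_parcs_converse: "wf ((parcs T)\<inverse>)"
proof -
  interpret M: wf_digraph "with_proj (mk_symmetric T)" by (fact wf_underlying)
  define d where "d v = length (THE p. M.apath r p v)" for v
  have d: "d v = length p" if p: "M.apath r p v" for p v
  proof -
    have "v \<in> verts (with_proj (mk_symmetric T))"
      using p by (auto simp only: M.apath_def dest: M.awalk_last_in_verts)
    then have "v \<in> pverts T" by (simp add: mk_symmetric_def)
    then have "\<exists>!p. M.apath r p v"
      using tree root unfolding underlying_tree_def by blast
    then have "(THE p. M.apath r p v) = p" using p by (rule the1_equality)
    then show ?thesis by (simp only: d_def)
  qed
  have "d u < d v" if uv: "(u, v) \<in> parcs T" for u v
  proof -
    from directed_away[OF uv] obtain p where p: "M.apath r (p @ [(u, v)]) v" by blast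
    then have w: "M.awalk r p u" and "distinct (M.awalk_verts r (p @ [(u, v)]))"
      by (auto simp: M.apath_def M.awalk_simps)
    moreover have "M.awalk_verts r (p @ [(u, v)]) = M.awalk_verts r p @ [v]"
      using p M.awalk_verts_append[of r p "[(u, v)]" v] by (simp add: M.apath_def)
    ultimately have "M.apath r p u" by (simp add: M.apath_def)
    with p show ?thesis by (simp add: d)
  qed
  then have "acyclic (parcs T)"
    by (intro acyclic_subset[OF wf_acyclic[OF wf_measure[of d]]]) auto
  then show ?thesis by (intro finite_acyclic_wf_converse pair_finite_arcs)
qed

lemma parent_unique:
  assumes "(u, v) \<in> parcs T" "(u', v) \<in> parcs T"
  shows "u = u'"
proof -
  interpret M: wf_digraph "with_proj (mk_symmetric T)" by (fact wf_underlying)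
  obtain p p' where p: "M.apath r (p @ [(u, v)]) v" "M.apath r (p' @ [(u', v)]) v"
    using directed_away[OF assms(1)] directed_away[OF assms(2)] by blast
  have "v \<in> pverts T" using arc_snd_in_verts[OF assms(1)] by simp
  then have "p @ [(u, v)] = p' @ [(u', v)]"
    using p tree root unfolding underlying_tree_def by blast
  then show ?thesis by simp
qed

lemma finite_children: "finite (children T u)"
proof -
  have "children T u \<subseteq> snd ` parcs T" by (force simp: children_def)
  then show ?thesis by (rule finite_subset) simp
qed

lemma ex_sorted_children:
  fixes key :: "'a \<Rightarrow> 'k :: linorder"
  shows "\<exists>ns. distinct ns \<and> set ns = children T u \<and> sorted (map key ns)"
proof -
  obtain xs where "set xs = children T u" "distinct xs"
    using finite_distinct_list[OF finite_children] by blast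
  then show ?thesis by (intro exI[of _ "sort_key key xs"]) simp
qed

text \<open>
  The order on arrays is the one of \<open>List_Lexorder\<close>, in which a proper prefix is smaller, applied at
  both levels of nesting. As the children of a descendant of \<open>u\<close> are the same in \<open>T[u]\<close> and in \<open>T\<close>,
  the array of \<open>T[u]\<close> is a function of \<open>u\<close>. The choice operator breaks the remaining ties; it
  does not affect the value, as tied children contribute the same color and the same array.
\<close>
context
  notes conj_cong [fundef_cong]
begin

function LDA :: "'a \<Rightarrow> nat list list" where
  "LDA u =
    (let ns = (SOME ns. distinct ns \<and> set ns = children T u \<and> sorted (map (\<lambda>v. (c v, LDA v)) ns))
     in map c ns # concat (map LDA ns))"
  by pat_completeness auto
termination
proof (relation "(parcs T)\<inverse>")
  show "wf ((parcs T)\<inverse>)" using wf_parcs_converse .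
next
  fix u v and ns :: "'a list"
  assume "set ns = children T u" "v \<in> set ns"
  then show "(v, u) \<in> (parcs T)\<inverse>" by (auto simp: children_def)
next
  fix u v ns
  assume "ns = (SOME ns. distinct ns \<and> set ns = children T u \<and> sorted (map (\<lambda>v. (c v, LDA v)) ns))"
    and v: "v \<in> set ns"
  with someI_ex[OF ex_sorted_children[of u "\<lambda>v. (c v, LDA v)"]] have "set ns = children T u"
    by simp
  with v show "(v, u) \<in> (parcs T)\<inverse>" by (auto simp: children_def)
qed

declare LDA.simps [simp del]

end

text \<open>
  Any two orders satisfying \<open>sorted_children u\<close> differ only in how they break ties.
\<close>
definition sorted_children :: "'a \<Rightarrow> 'a list \<Rightarrow> bool" where
  "sorted_children u ns \<longleftrightarrow>
     distinct ns \<and> set ns = children T u \<and> sorted (map (\<lambda>v. (c v, LDA v)) ns)"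

inductive preorder :: "'a \<Rightarrow> 'a list \<Rightarrow> bool" where
  "sorted_children u ns \<Longrightarrow> list_all2 preorder ns vss \<Longrightarrow> preorder u (u # concat vss)"

definition dfs_numbering :: "('a \<Rightarrow> nat) \<Rightarrow> bool" where
  "dfs_numbering \<phi> \<longleftrightarrow> (\<exists>vs. preorder r vs \<and> (\<forall>i < length vs. \<phi> (vs ! i) = i))"

end

text \<open>
  A \<open>2 \<times> m\<close> array is the list of its \<open>m\<close> columns; \<open>None\<close> stands for the entry \<open>\<emptyset>\<close>.
\<close>
fun prune :: "('a \<Rightarrow> nat) \<Rightarrow> ('a \<Rightarrow> nat) \<Rightarrow> nat \<Rightarrow> ('a, 'b) pre_digraph \<Rightarrow> (nat option \<times> nat) list" where
  "prune \<phi> c 0 G = []"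
| "prune \<phi> c (Suc k) G =
    (let v = (ARG_MIN \<phi> v. v \<in> verts G \<and> out_degree G v = 0)
     in (Some (\<phi> (parent G v)), c v) # prune \<phi> c k (pre_digraph.del_vert G v))"

context colored_arborescence
begin

text \<open>
  A relation rather than a function, since the numbering depends on how ties are broken.
\<close>
definition is_vcpc :: "(nat option \<times> nat) list \<Rightarrow> bool" where
  "is_vcpc P \<longleftrightarrow>
     (\<exists>\<phi>. dfs_numbering \<phi> \<and> P = prune \<phi> c (card (pverts T) - 1) T @ [(None, c r)])"

lemma ex_preorder:
  "\<exists>vs. preorder u vs \<and> distinct vs \<and> (\<forall>v \<in> set vs. (u, v) \<in> (parcs T)\<^sup>*)"
proof (induction u rule: wf_induct_rule[OF wf_parcs_converse])
  case (1 u)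
  obtain ns where ns: "sorted_children u ns"
    using ex_sorted_children[of u "\<lambda>v. (c v, LDA v)"] unfolding sorted_children_def by blast
  then have set_ns: "set ns = children T u" and dist_ns: "distinct ns"
    by (auto simp: sorted_children_def)
  have "\<forall>v \<in> set ns. \<exists>vs. preorder v vs \<and> distinct vs \<and> (\<forall>w \<in> set vs. (v, w) \<in> (parcs T)\<^sup>*)"
    using 1 by (simp add: set_ns children_def)
  from bchoice[OF this] obtain f where "\<forall>v \<in> set ns. preorder v (f v) \<and> distinct (f v) \<and>
    (\<forall>w \<in> set (f v). (v, w) \<in> (parcs T)\<^sup>*)" ..
  then have f: "\<And>v. v \<in> set ns \<Longrightarrow> preorder v (f v)"
    "\<And>v. v \<in> set ns \<Longrightarrow> distinct (f v)"
    "\<And>v w. v \<in> set ns \<Longrightarrow> w \<in> set (f v) \<Longrightarrow> (v, w) \<in> (parcs T)\<^sup>*"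
    by blast+
  have acyc: "(u, u) \<notin> (parcs T)\<^sup>+"
    using wf_acyclic[OF wf_parcs_converse] by (simp add: acyclic_def trancl_converse)
  have no_path: False if vs: "v \<in> set ns" "v' \<in> set ns" "v \<noteq> v'" "(v, v') \<in> (parcs T)\<^sup>*" for v v'
  proof -
    obtain x where x: "(v, x) \<in> (parcs T)\<^sup>*" "(x, v') \<in> parcs T"
      using vs(4) by (rule rtranclE) (use vs(3) in blast)+
    have uv: "(u, v) \<in> parcs T" "(u, v') \<in> parcs T"
      using vs(1,2) by (simp_all add: set_ns children_def)
    have "x = u" using x(2) uv(2) by (rule parent_unique)
    with x(1) have "(u, u) \<in> (parcs T)\<^sup>+" using uv(1) by (blast intro: rtrancl_into_trancl2)
    with acyc show False ..
  qed
  have sv: "single_valued ((parcs T)\<inverse>)"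
    unfolding single_valued_def using parent_unique by blast
  have disj: "set (f v) \<inter> set (f v') = {}" if v: "v \<in> set ns" "v' \<in> set ns" "v \<noteq> v'" for v v'
  proof (rule equals0I)
    fix w assume w: "w \<in> set (f v) \<inter> set (f v')"
    then have "(w, v) \<in> ((parcs T)\<inverse>)\<^sup>*" "(w, v') \<in> ((parcs T)\<inverse>)\<^sup>*"
      using f(3)[OF v(1)] f(3)[OF v(2)] by (simp_all add: rtrancl_converse)
    from single_valued_confluent[OF sv this]
    have "(v', v) \<in> (parcs T)\<^sup>* \<or> (v, v') \<in> (parcs T)\<^sup>*"
      by (simp only: rtrancl_converse converse_iff)
    then show False using no_path[OF v] no_path[OF v(2,1) v(3)[symmetric]] by blast
  qed
  have "distinct (concat (map f xs))" if "set xs \<subseteq> set ns" "distinct xs" for xs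
    using that
  proof (induction xs)
    case (Cons x xs)
    moreover have "set (f x) \<inter> set (f y) = {}" if "y \<in> set xs" for y
      using Cons.prems that by (intro disj) auto
    ultimately show ?case using f(2) by auto
  qed simp
  then have "distinct (concat (map f ns))" using dist_ns by simp
  moreover have desc: "(u, w) \<in> (parcs T)\<^sup>+" if w: "w \<in> set (concat (map f ns))" for w
  proof -
    obtain v where "v \<in> set ns" "w \<in> set (f v)" using w by auto
    moreover from this have "(u, v) \<in> parcs T" by (simp add: set_ns children_def)
    ultimately show ?thesis by (blast intro: rtrancl_into_trancl2 f(3))
  qed
  moreover have "preorder u (u # concat (map f ns))"
    using ns f(1) by (intro preorder.intros) (auto simp: list_all2_conv_all_nth)
  moreover have "u \<notin> set (concat (map f ns))" using desc acyc by blast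
  ultimately show ?case
    by (intro exI[of _ "u # concat (map f ns)"])
      (simp only: distinct.simps list.set, blast intro: trancl_into_rtrancl)
qed

lemma ex_vcpc: "\<exists>P. is_vcpc P"
proof -
  obtain vs where vs: "preorder r vs" "distinct vs" using ex_preorder by blast
  then have "dfs_numbering (the_inv_into {..<length vs} (\<lambda>i. vs ! i))"
    unfolding dfs_numbering_def
    by (intro exI[of _ vs]) (auto simp: inj_on_nth intro!: the_inv_into_f_f)
  then show ?thesis unfolding is_vcpc_def by blast
qed

end

end

theory Submission
  imports Defs
begin

text \<open>
  A tree numbered by \<open>\<phi>\<close> amounts to two sets of pairs of numbers: its arcs \<open>(\<phi> u, \<phi> v)\<close> and
  its colors \<open>(\<phi> v, c v)\<close>. For a depth-first numbering both are determined by the color of the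
  root and \<open>LDA r\<close>: a block of the array shows how many blocks of children follow, so arrays of
  subtrees form a prefix-free code and can be parsed back along any preorder. As \<open>LDA\<close> is invariant
  under isomorphism, isomorphic trees have depth-first numberings that correspond under some
  isomorphism, whence equal codes. Conversely, equal codes yield the same pairs by Pruefer decoding,
  and equal pairs yield an isomorphism that preserves the numbering.
\<close>

section \<open>Parsing concatenations, zips of blocks, and induced subgraphs\<close>

text \<open>Blocks that can be split off uniquely are removed one by one from the left. Two
  functions \<open>f\<close> and \<open>g\<close> are needed since the blocks will be arrays of two
  trees with different vertex types.\<close>

lemma concat_eq_prefix_free:
  assumes "list_all2 (\<lambda>x y. \<forall>xs ys. f x @ xs = g y @ ys \<longrightarrow> f x = g y \<and> xs = ys) as bs"
    and "concat (map f as) @ xs = concat (map g bs) @ ys"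
  shows "map f as = map g bs \<and> xs = ys"
  using assms
proof (induction as bs arbitrary: xs ys rule: list_all2_induct)
  case (Cons a as b bs)
  from Cons.prems have "f a @ (concat (map f as) @ xs) = g b @ (concat (map g bs) @ ys)" by simp
  with Cons.hyps(1) have "f a = g b" "concat (map f as) @ xs = concat (map g bs) @ ys" by blast+
  with Cons.IH show ?case by simp
qed simp

text \<open>Blocks of equal lengths keep the pairing aligned with the block boundaries, so no pair
  straddles two subtrees.\<close>

lemma set_zip_concat:
  assumes "list_all2 (\<lambda>xs ys. length xs = length ys) xss yss"
  shows "set (zip (concat xss) (concat yss)) = (\<Union>(xs, ys) \<in> set (zip xss yss). set (zip xs ys))"
  using assms by (induction rule: list_all2_induct) auto

text \<open>Every tree met during pruning is thus of the form \<open>T \<restriction> S\<close>,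
  which allows inductions over the vertex set \<open>S\<close>.\<close>

lemma del_vert_induce_subgraph:
  "pre_digraph.del_vert (G \<restriction> S) v = G \<restriction> (S - {v})"
  by (auto simp: pre_digraph.del_vert_def induce_subgraph_def)

lemma length_prune: "length (prune \<phi> c n G) = n"
  by (induction n arbitrary: G) (simp_all add: Let_def)

lemma (in wf_digraph) induce_subgraph_verts_eq: "G \<restriction> verts G = G"
  by (rule pre_digraph.equality) auto

section \<open>Root, parents and reachability in one arborescence\<close>

context colored_arborescence
begin

lemma acyclic: "(u, u) \<notin> (parcs T)\<^sup>+"
  using wf_acyclic[OF wf_parcs_converse] by (simp add: acyclic_def trancl_converse)

text \<open>Such an arc would end a nonempty simple path from \<open>r\<close> to \<open>r\<close>,
  next to the empty one.\<close>

lemma no_arc_to_root: "(u, r) \<notin> parcs T"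
proof
  assume "(u, r) \<in> parcs T"
  from directed_away[OF this] obtain p where p: "pre_digraph.apath (mk_symmetric T) r (p @ [(u, r)]) r"
    by blast
  interpret M: wf_digraph "with_proj (mk_symmetric T)" by (fact wf_underlying)
  have "M.apath r [] r" unfolding M.apath_Nil_iff using root by (simp add: mk_symmetric_def)
  with p root tree show False unfolding underlying_tree_def by blast
qed

text \<open>The undirected simple path from \<open>r\<close> to \<open>v\<close> traverses all its
  arcs forward, by induction on its last arc.\<close>

lemma reachable_from_root:
  assumes "v \<in> pverts T"
  shows "(r, v) \<in> (parcs T)\<^sup>*"
proof -
  interpret M: wf_digraph "with_proj (mk_symmetric T)" by (fact wf_underlying)
  have uniq: "p = q" if "M.apath r p w" "M.apath r q w" for p q w
  proof -
    have "w \<in> verts (with_proj (mk_symmetric T))"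
      using that(1) by (auto simp only: M.apath_def dest: M.awalk_last_in_verts)
    then have "w \<in> pverts T" by (simp add: mk_symmetric_def)
    with that tree root show ?thesis unfolding underlying_tree_def by blast
  qed
  have "(r, v) \<in> (parcs T)\<^sup>*" if "M.apath r p v" for p v
    using that
  proof (induction p arbitrary: v rule: rev_induct)
    case Nil
    then show ?case by (simp add: M.apath_Nil_iff)
  next
    case (snoc e p)
    obtain x y where e: "e = (x, y)" by (cases e)
    have y: "y = v" and w: "M.awalk r p x" and arc: "(x, v) \<in> parcs (mk_symmetric T)"
      using snoc.prems by (auto simp: e M.apath_def M.awalk_simps)
    have verts: "M.awalk_verts r (p @ [(x, v)]) = M.awalk_verts r p @ [v]"
      using snoc.prems M.awalk_verts_append[of r p "[(x, v)]" v] by (simp add: M.apath_def e y)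
    have p: "M.apath r p x"
      using snoc.prems w verts by (simp add: M.apath_def e y)
    have "(x, v) \<in> parcs T"
    proof (rule ccontr)
      assume "(x, v) \<notin> parcs T"
      with arc have "(v, x) \<in> parcs T" by (auto simp: mk_symmetric_def symcl_def)
      from directed_away[OF this] obtain q where q: "M.apath r (q @ [(v, x)]) x" by blast
      \<comment> \<open>If the last arc were traversed backward, the path to \<open>x\<close> would
        already visit \<open>v\<close>, and its extension to \<open>v\<close> would not be
        simple.\<close>
      have "p = q @ [(v, x)]" using uniq[OF p q] .
      moreover have "v \<in> set (M.awalk_verts r (q @ [(v, x)]))"
        using q M.awalk_verts_append[of r q "[(v, x)]" x]
        by (auto simp: M.apath_def M.awalk_simps dest: M.awlast_in_verts)
      ultimately have "v \<in> set (M.awalk_verts r p)" by simp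
      with snoc.prems verts show False by (simp add: M.apath_def e y)
    qed
    with snoc.IH[OF p] show ?case by (rule rtrancl_into_rtrancl)
  qed
  then show ?thesis using assms tree root unfolding underlying_tree_def by blast
qed

lemma ex_arc_to:
  assumes "v \<in> pverts T" "v \<noteq> r"
  shows "\<exists>u. (u, v) \<in> parcs T"
  using reachable_from_root[OF assms(1)] assms(2) by (auto elim: rtranclE)

section \<open>The array \<open>LDA\<close> and the preorder lists\<close>

text \<open>Two lists sorted by key with the same multiset of keys have the same sequence of keys,
  so the way ties are broken does not show in the array.\<close>

lemma LDA_eq:
  assumes "sorted_children u ns"
  shows "LDA u = map c ns # concat (map LDA ns)"
proof -
  define ms where "ms = (SOME ns. sorted_children u ns)"
  have "sorted_children u ms"
    unfolding ms_def sorted_children_def by (rule someI_ex[OF ex_sorted_children])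
  moreover from this have "mset ms = mset ns"
    using assms unfolding sorted_children_def by (metis set_eq_iff_mset_eq_distinct)
  then have "mset (map (\<lambda>v. (c v, LDA v)) ms) = mset (map (\<lambda>v. (c v, LDA v)) ns)" by simp
  ultimately have eq: "map (\<lambda>v. (c v, LDA v)) ms = map (\<lambda>v. (c v, LDA v)) ns"
    using assms unfolding sorted_children_def by (metis properties_for_sort)
  have eq: "map c ms = map c ns" "map LDA ms = map LDA ns"
    using arg_cong[OF eq, of "map fst"] arg_cong[OF eq, of "map snd"] by (simp_all add: comp_def)
  have "LDA u = map c ms # concat (map LDA ms)"
    by (subst LDA.simps) (simp add: ms_def sorted_children_def Let_def)
  then show ?thesis by (simp only: eq)
qed

text \<open>Each visited vertex contributes exactly one block to the array.\<close>

lemma length_preorder: "preorder u vs \<Longrightarrow> length vs = length (LDA u)"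
proof (induction rule: preorder.induct)
  case (1 u ns vss)
  have "length (concat vss) = length (concat (map LDA ns))"
    using 1(2) by (induction rule: list_all2_induct) auto
  then show ?case by (simp add: LDA_eq[OF 1(1)])
qed

lemma set_preorder: "preorder u vs \<Longrightarrow> set vs = {v. (u, v) \<in> (parcs T)\<^sup>*}"
proof (induction rule: preorder.induct)
  case (1 u ns vss)
  have "set (concat vss) = (\<Union>n \<in> set ns. {v. (n, v) \<in> (parcs T)\<^sup>*})"
    using 1(2) by (induction rule: list_all2_induct) auto
  moreover have "set ns = {v. (u, v) \<in> parcs T}"
    using 1(1) by (simp add: sorted_children_def children_def)
  ultimately show ?case
    by (auto intro: converse_rtrancl_into_rtrancl elim: converse_rtranclE)
qed

text \<open>All preorders from \<open>u\<close> have the same set and the same length as the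
  distinct one given by \<open>ex_preorder\<close>, so counting forces distinctness.\<close>

lemma distinct_preorder:
  assumes "preorder u vs"
  shows "distinct vs"
proof -
  obtain ws where ws: "preorder u ws" "distinct ws" using ex_preorder by blast
  then have "card (set vs) = length ws"
    using assms by (simp add: set_preorder distinct_card[symmetric])
  then show ?thesis
    using assms ws(1) by (intro card_distinct) (simp add: length_preorder)
qed

lemma set_preorder_root:
  assumes "preorder r vs"
  shows "set vs = pverts T"
proof -
  have "v \<in> pverts T" if "(r, v) \<in> (parcs T)\<^sup>*" for v
    using that root by (induction) (auto dest: in_arcsD2)
  then show ?thesis using assms by (auto simp: set_preorder reachable_from_root)
qed

lemma bij_betw_dfs_numbering:
  assumes "dfs_numbering \<phi>"
  shows "bij_betw \<phi> (pverts T) {..<card (pverts T)}"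
proof -
  from assms obtain vs where vs: "preorder r vs" "\<And>i. i < length vs \<Longrightarrow> \<phi> (vs ! i) = i"
    unfolding dfs_numbering_def by blast
  have map: "map \<phi> vs = [0..<length vs]" by (rule nth_equalityI) (simp_all add: vs(2))
  then have "distinct (map \<phi> vs)" by simp
  moreover from map have "\<phi> ` set vs = {..<length vs}" by (metis atLeast_upt set_map)
  ultimately show ?thesis
    using set_preorder_root[OF vs(1)] distinct_card[OF distinct_preorder[OF vs(1)]]
    by (simp add: bij_betw_def distinct_map)
qed

section \<open>Vertex sets of partially pruned trees\<close>

text \<open>Containing the root and being closed under parents is the invariant of pruning: every
  vertex of \<open>S\<close> keeps its path from \<open>r\<close>.\<close>

definition rooted :: "'a set \<Rightarrow> bool" where
  "rooted S \<longleftrightarrow> r \<in> S \<and> S \<subseteq> pverts T \<and> (\<forall>u v. (u, v) \<in> parcs T \<longrightarrow> v \<in> S \<longrightarrow> u \<in> S)"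

definition leaves :: "'a set \<Rightarrow> 'a set" where
  "leaves S = {v \<in> S. children T v \<inter> S = {}}"

lemma rooted_pverts: "rooted (pverts T)"
  using root by (auto simp: rooted_def dest: in_arcsD1)

lemma rooted_Diff: "rooted S \<Longrightarrow> v \<in> leaves S \<Longrightarrow> v \<noteq> r \<Longrightarrow> rooted (S - {v})"
  by (auto simp: rooted_def leaves_def children_def)

text \<open>Absence from \<open>S\<close> propagates down the arcs: if no child of \<open>r\<close>
  were in \<open>S\<close>, no other vertex would be.\<close>

lemma root_notin_leaves:
  assumes "rooted S" "x \<in> S" "x \<noteq> r"
  shows "r \<notin> leaves S"
proof -
  have "\<exists>y \<in> S. (r, y) \<in> parcs T"
  proof (rule ccontr)
    assume no: "\<not> ?thesis"
    have "y \<noteq> r \<longrightarrow> y \<notin> S" if "(r, y) \<in> (parcs T)\<^sup>*" for y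
      using that
    proof (induction)
      case (step y z)
      then show ?case using no assms(1) unfolding rooted_def by blast
    qed simp
    moreover have "(r, x) \<in> (parcs T)\<^sup>*"
      using assms(1,2) by (intro reachable_from_root) (auto simp: rooted_def)
    ultimately show False using assms by blast
  qed
  then show ?thesis by (auto simp: leaves_def children_def)
qed

lemma leaves_nonempty:
  assumes "rooted S"
  shows "leaves S \<noteq> {}"
proof -
  obtain v where "v \<in> S" "\<And>y. (y, v) \<in> (parcs T)\<inverse> \<Longrightarrow> y \<notin> S"
    using wfE_min[OF wf_parcs_converse, of r S] assms unfolding rooted_def by blast
  then show ?thesis by (auto simp: leaves_def children_def)
qed

lemma out_degree_induce_subgraph:
  assumes "v \<in> S"
  shows "out_degree (T \<restriction> S) v = 0 \<longleftrightarrow> children T v \<inter> S = {}"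
proof -
  have "out_arcs (T \<restriction> S) v = Pair v ` (children T v \<inter> S)"
    using assms by (auto simp: out_arcs_def children_def)
  then show ?thesis
    using finite_children[of v] by (simp add: out_degree_def)
qed

lemma parent_induce_subgraph:
  assumes "(u, v) \<in> parcs T" "u \<in> S" "v \<in> S"
  shows "parent (T \<restriction> S) v = u"
  unfolding parent_def using assms parent_unique
  by (intro the_equality) (auto simp: arcs_ends_conv)

text \<open>With at least two vertices left, the removed leaf is not the root, hence has a parent,
  which lies in \<open>S\<close> as well.\<close>

lemma prune_step:
  assumes inj: "inj_on \<phi> (pverts T)" and S: "rooted S" "card S = Suc (Suc k)"
  obtains u v where "v \<in> leaves S" "v \<noteq> r" "(u, v) \<in> parcs T" "u \<in> S"
    "\<And>w. w \<in> leaves S \<Longrightarrow> \<phi> v \<le> \<phi> w"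
    "prune \<phi> c (Suc k) (T \<restriction> S) = (Some (\<phi> u), c v) # prune \<phi> c k (T \<restriction> (S - {v}))"
proof -
  define v where "v = (ARG_MIN \<phi> v. v \<in> leaves S)"
  obtain l where "l \<in> leaves S" using leaves_nonempty[OF S(1)] by blast
  then have v: "v \<in> leaves S" and min: "\<And>w. w \<in> leaves S \<Longrightarrow> \<phi> v \<le> \<phi> w"
    using arg_min_nat_lemma[of "\<lambda>v. v \<in> leaves S" l \<phi>] unfolding v_def by blast+
  have "S \<noteq> {r}" using S(2) by auto
  then obtain x where "x \<in> S" "x \<noteq> r" using S(1) unfolding rooted_def by blast
  with v have "v \<noteq> r" using root_notin_leaves[OF S(1)] by blast
  moreover have "v \<in> S" using v by (simp add: leaves_def)
  ultimately obtain u where u: "(u, v) \<in> parcs T" "u \<in> S"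
    using ex_arc_to[of v] S(1) unfolding rooted_def by blast
  have "(ARG_MIN \<phi> v. v \<in> verts (T \<restriction> S) \<and> out_degree (T \<restriction> S) v = 0) = v"
    unfolding v_def leaves_def
    by (rule arg_cong[of _ _ "arg_min \<phi>"]) (auto simp: fun_eq_iff out_degree_induce_subgraph)
  then have "prune \<phi> c (Suc k) (T \<restriction> S) = (Some (\<phi> u), c v) # prune \<phi> c k (T \<restriction> (S - {v}))"
    using parent_induce_subgraph[OF u \<open>v \<in> S\<close>]
    by (simp add: del_vert_induce_subgraph del: induce_subgraph_verts)
  with v \<open>v \<noteq> r\<close> u min that show thesis by blast
qed

section \<open>The numbered tree as sets of pairs of numbers\<close>

text \<open>Passing to labels makes trees over different vertex types comparable by plain equality
  of sets.\<close>

definition labelled_arcs :: "('a \<Rightarrow> nat) \<Rightarrow> 'a set \<Rightarrow> (nat \<times> nat) set" where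
  "labelled_arcs \<phi> S = map_prod \<phi> \<phi> ` (parcs T \<inter> S \<times> S)"

definition labelled_colors :: "('a \<Rightarrow> nat) \<Rightarrow> 'a set \<Rightarrow> (nat \<times> nat) set" where
  "labelled_colors \<phi> S = (\<lambda>v. (\<phi> v, c v)) ` S"

lemma labelled_arcs_iff:
  assumes "inj_on \<phi> (pverts T)" "u \<in> pverts T" "v \<in> pverts T"
  shows "(\<phi> u, \<phi> v) \<in> labelled_arcs \<phi> (pverts T) \<longleftrightarrow> (u, v) \<in> parcs T"
  using inj_on_image_mem_iff[OF map_prod_inj_on[OF assms(1,1)],
      of "(u, v)" "parcs T \<inter> pverts T \<times> pverts T"] assms(2,3)
  by (simp add: labelled_arcs_def)

text \<open>The arc from its unique parent is the only arc within \<open>S\<close> at a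
  leaf.\<close>

lemma labelled_arcs_leaf:
  assumes "v \<in> leaves S" "(u, v) \<in> parcs T" "u \<in> S"
  shows "labelled_arcs \<phi> S = insert (\<phi> u, \<phi> v) (labelled_arcs \<phi> (S - {v}))"
proof -
  have "u \<noteq> v" using assms(2) acyclic by blast
  then have "parcs T \<inter> S \<times> S = insert (u, v) (parcs T \<inter> (S - {v}) \<times> (S - {v}))"
    using assms parent_unique unfolding leaves_def children_def by blast
  then show ?thesis by (simp add: labelled_arcs_def)
qed

lemma labelled_colors_insert:
  "v \<in> S \<Longrightarrow> labelled_colors \<phi> S = insert (\<phi> v, c v) (labelled_colors \<phi> (S - {v}))"
  by (auto simp: labelled_colors_def)

lemma rooted_singleton:
  assumes "rooted S" "card S = 1"
  shows "labelled_arcs \<phi> S = {}" "S = {r}"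
proof -
  show "S = {r}" using assms by (auto simp: rooted_def card_1_singleton_iff)
  then show "labelled_arcs \<phi> S = {}" using acyclic by (auto simp: labelled_arcs_def)
qed

text \<open>Each non-root vertex of \<open>S\<close> is removed once, and its column records the
  tail of the arc above it. With \<open>image_leaves\<close>, the code therefore reveals the labels
  of the leaves.\<close>

lemma fst_set_prune:
  assumes "inj_on \<phi> (pverts T)" "rooted S" "card S = Suc k"
  shows "fst ` set (prune \<phi> c k (T \<restriction> S)) = Some ` fst ` labelled_arcs \<phi> S"
  using assms(2,3)
proof (induction k arbitrary: S)
  case 0
  then show ?case by (simp add: rooted_singleton)
next
  case (Suc k)
  obtain u v where v: "v \<in> leaves S" "v \<noteq> r" "(u, v) \<in> parcs T" "u \<in> S"
    "prune \<phi> c (Suc k) (T \<restriction> S) = (Some (\<phi> u), c v) # prune \<phi> c k (T \<restriction> (S - {v}))"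
    using prune_step[OF assms(1) Suc.prems] by metis
  have "card (S - {v}) = Suc k" using Suc.prems v(1) by (simp add: leaves_def)
  from Suc.IH[OF rooted_Diff[OF Suc.prems(1) v(1,2)] this]
  show ?case by (simp add: v(5) labelled_arcs_leaf[OF v(1,3,4)] del: prune.simps)
qed

lemma image_leaves:
  assumes "inj_on \<phi> (pverts T)" "rooted S"
  shows "\<phi> ` leaves S = \<phi> ` S - fst ` labelled_arcs \<phi> S"
proof -
  have "fst ` labelled_arcs \<phi> S = \<phi> ` (S - leaves S)"
    by (force simp: labelled_arcs_def leaves_def children_def)
  moreover have "\<phi> ` S - \<phi> ` (S - leaves S) = \<phi> ` (S - (S - leaves S))"
    using assms by (intro inj_on_image_set_diff[symmetric]) (auto simp: rooted_def)
  moreover have "S - (S - leaves S) = leaves S" by (auto simp: leaves_def)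
  ultimately show ?thesis by simp
qed

end

section \<open>Parsing the arrays of two trees in parallel\<close>

locale colored_arborescence_pair =
  L: colored_arborescence T r c + R: colored_arborescence T' r' c'
  for T :: "'a pair_pre_digraph" and r c and T' :: "'b pair_pre_digraph" and r' c'
begin

text \<open>The first block fixes the number of children, hence how many child arrays follow; each
  of them can be split off by induction. The rule of \<open>preorder\<close> provides the induction
  over the subtree of \<open>u\<close>.\<close>

lemma LDA_prefix_free:
  assumes "L.preorder u vs" "L.LDA u @ xs = R.LDA u' @ ys"
  shows "L.LDA u = R.LDA u' \<and> xs = ys"
  using assms
proof (induction arbitrary: u' xs ys rule: L.preorder.induct)
  case (1 u ns vss)
  obtain ns' where ns': "R.sorted_children u' ns'"
    using R.ex_sorted_children unfolding R.sorted_children_def by blast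
  have "map c ns = map c' ns'"
    and eq: "concat (map L.LDA ns) @ xs = concat (map R.LDA ns') @ ys"
    using 1(3) by (simp_all add: L.LDA_eq[OF 1(1)] R.LDA_eq[OF ns'])
  then have "list_all2 (\<lambda>x y. \<forall>xs ys. L.LDA x @ xs = R.LDA y @ ys \<longrightarrow> L.LDA x = R.LDA y \<and> xs = ys) ns ns'"
    using 1(2) by (auto simp: list_all2_conv_all_nth dest: map_eq_imp_length_eq)
  from concat_eq_prefix_free[OF this eq] \<open>map c ns = map c' ns'\<close>
  show ?case by (simp add: L.LDA_eq[OF 1(1)] R.LDA_eq[OF ns'])
qed

text \<open>Prefix-freeness recovers the boundaries between the child arrays, which concatenation
  hides.\<close>

lemma LDA_eq_children:
  assumes "L.sorted_children u ns" "R.sorted_children u' ns'" "L.LDA u = R.LDA u'"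
  shows "map c ns = map c' ns'" "map L.LDA ns = map R.LDA ns'"
proof -
  show c: "map c ns = map c' ns'"
    using assms(3) by (simp add: L.LDA_eq[OF assms(1)] R.LDA_eq[OF assms(2)])
  have "concat (map L.LDA ns) @ [] = concat (map R.LDA ns') @ []"
    using assms(3) by (simp add: L.LDA_eq[OF assms(1)] R.LDA_eq[OF assms(2)])
  moreover have "list_all2 (\<lambda>x y. \<forall>xs ys. L.LDA x @ xs = R.LDA y @ ys \<longrightarrow> L.LDA x = R.LDA y \<and> xs = ys) ns ns'"
    using map_eq_imp_length_eq[OF c] LDA_prefix_free L.ex_preorder
    unfolding list_all2_conv_all_nth by blast
  ultimately show "map L.LDA ns = map R.LDA ns'" using concat_eq_prefix_free by blast
qed

text \<open>Vertices are paired by their position. Equal arrays make the children agree in number,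
  colors and arrays, so the subtrees are paired block by block.\<close>

lemma preorder_bisimulation:
  assumes "L.preorder u vs" "R.preorder u' vs'" "L.LDA u = R.LDA u'" "c u = c' u'"
  shows "\<forall>(x, x') \<in> set (zip vs vs'). c x = c' x' \<and>
    (\<forall>y. (x, y) \<in> parcs T \<longrightarrow> (\<exists>y'. (y, y') \<in> set (zip vs vs') \<and> (x', y') \<in> parcs T'))"
  using assms
proof (induction arbitrary: u' vs' rule: L.preorder.induct)
  case (1 u ns vss)
  obtain ns' vss' where vs': "vs' = u' # concat vss'"
    and ns': "R.sorted_children u' ns'" and pre': "list_all2 R.preorder ns' vss'"
    using 1(3) by (auto elim: R.preorder.cases)
  note eq = LDA_eq_children[OF 1(1) ns' 1(4)]
  have len: "length ns = length ns'" "length ns = length vss" "length ns' = length vss'"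
    using map_eq_imp_length_eq[OF eq(1)] 1(2) pre' by (auto dest: list_all2_lengthD)
  have pre: "L.preorder (ns ! i) (vss ! i)" "R.preorder (ns' ! i) (vss' ! i)"
    and c: "c (ns ! i) = c' (ns' ! i)" and LDA: "L.LDA (ns ! i) = R.LDA (ns' ! i)"
    if "i < length ns" for i
    using that 1(2) pre' len eq
    by (auto simp: list_all2_conv_all_nth list_eq_iff_nth_eq)
  have same_length: "length (vss ! i) = length (vss' ! i)" if "i < length ns" for i
    using pre[OF that] LDA[OF that] by (simp add: L.length_preorder R.length_preorder)
  \<comment> \<open>\<open>Z i\<close> pairs the vertices of the two \<open>i\<close>-th child
    subtrees.\<close>
  define Z where "Z i = set (zip (vss ! i) (vss' ! i))" for i
  have "list_all2 (\<lambda>xs ys. length xs = length ys) vss vss'"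
    using len same_length by (simp add: list_all2_conv_all_nth)
  note concat = set_zip_concat[OF this]
  have zip: "set (zip (u # concat vss) vs') = insert (u, u') (\<Union>i < length ns. Z i)"
  proof -
    have "set (zip vss vss') = (\<lambda>i. (vss ! i, vss' ! i)) ` {..<length ns}"
      using len by (auto simp: set_zip)
    with concat show ?thesis by (simp add: vs' Z_def)
  qed
  \<comment> \<open>A preorder starts with its own root, so corresponding children are
    paired.\<close>
  have roots: "(ns ! i, ns' ! i) \<in> Z i" if i: "i < length ns" for i
    using pre[OF i] by (auto simp: Z_def elim!: L.preorder.cases R.preorder.cases)
  have arcs: "\<exists>i < length ns. y = ns ! i \<and> (u', ns' ! i) \<in> parcs T'" if "(u, y) \<in> parcs T" for y
  proof -
    have "y \<in> set ns" using that 1(1) by (simp add: L.sorted_children_def children_def)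
    then obtain i where "i < length ns" "y = ns ! i" by (auto simp: in_set_conv_nth)
    moreover from this have "ns' ! i \<in> set ns'" using len(1) by simp
    then have "ns' ! i \<in> children T' u'" using ns' by (simp add: R.sorted_children_def)
    ultimately show ?thesis by (auto simp: children_def)
  qed
  have IH: "\<forall>(x, x') \<in> Z i. c x = c' x' \<and>
      (\<forall>y. (x, y) \<in> parcs T \<longrightarrow> (\<exists>y'. (y, y') \<in> Z i \<and> (x', y') \<in> parcs T'))"
    if i: "i < length ns" for i
    using 1(2) i pre[OF i] LDA[OF i] c[OF i] unfolding Z_def list_all2_conv_all_nth by blast
  show ?case
    unfolding zip
  proof (rule ballI, rule case_prodI2)
    fix p x x' assume "p \<in> insert (u, u') (\<Union>i < length ns. Z i)" and p: "p = (x, x')"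
    then consider "x = u" "x' = u'" | i where "i < length ns" "(x, x') \<in> Z i" by blast
    then show "c x = c' x' \<and> (\<forall>y. (x, y) \<in> parcs T \<longrightarrow>
      (\<exists>y'. (y, y') \<in> insert (u, u') (\<Union>i < length ns. Z i) \<and> (x', y') \<in> parcs T'))"
    proof cases
      case 1
      have "\<exists>y'. (y, y') \<in> insert (u, u') (\<Union>i < length ns. Z i) \<and> (u', y') \<in> parcs T'"
        if uy: "(u, y) \<in> parcs T" for y
      proof -
        obtain i where "i < length ns" "y = ns ! i" "(u', ns' ! i) \<in> parcs T'"
          using arcs[OF uy] by blast
        with roots show ?thesis by blast
      qed
      with 1 \<open>c u = c' u'\<close> show ?thesis by blast
    next
      case 2
      then have "Z i \<subseteq> insert (u, u') (\<Union>i < length ns. Z i)" by blast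
      moreover have "c x = c' x' \<and>
          (\<forall>y. (x, y) \<in> parcs T \<longrightarrow> (\<exists>y'. (y, y') \<in> Z i \<and> (x', y') \<in> parcs T'))"
        using bspec[OF IH[OF 2(1)] 2(2)] by simp
      ultimately show ?thesis by (meson subsetD)
    qed
  qed
qed

text \<open>Paired vertices stand at the same position and so carry the same label. The reverse
  inclusions follow by exchanging the two trees.\<close>

lemma LDA_eq_labelled_subset:
  assumes "L.dfs_numbering \<phi>" "R.dfs_numbering \<phi>'" "L.LDA r = R.LDA r'" "c r = c' r'"
  shows "L.labelled_arcs \<phi> (pverts T) \<subseteq> R.labelled_arcs \<phi>' (pverts T')"
    and "L.labelled_colors \<phi> (pverts T) \<subseteq> R.labelled_colors \<phi>' (pverts T')"
proof -
  obtain vs vs' where vs: "L.preorder r vs" "R.preorder r' vs'"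
    and \<phi>: "\<forall>i < length vs. \<phi> (vs ! i) = i" "\<forall>i < length vs'. \<phi>' (vs' ! i) = i"
    using assms(1,2) unfolding L.dfs_numbering_def R.dfs_numbering_def by blast
  define Z where "Z = set (zip vs vs')"
  have bisim: "\<forall>(x, x') \<in> Z. c x = c' x' \<and>
      (\<forall>y. (x, y) \<in> parcs T \<longrightarrow> (\<exists>y'. (y, y') \<in> Z \<and> (x', y') \<in> parcs T'))"
    using preorder_bisimulation[OF vs assms(3,4)] unfolding Z_def .
  have Z: "\<phi> x = \<phi>' x'" "x' \<in> pverts T'" if "(x, x') \<in> Z" for x x'
    using that \<phi> R.set_preorder_root[OF vs(2)] by (auto simp: Z_def set_zip)
  have "length vs = length vs'"
    using vs assms(3) by (simp add: L.length_preorder R.length_preorder)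
  \<comment> \<open>As the lengths agree, \<open>zip\<close> drops no vertex.\<close>
  then have total: "\<exists>x'. (x, x') \<in> Z" if "x \<in> pverts T" for x
  proof -
    have "x \<in> set vs" using that by (simp add: L.set_preorder_root[OF vs(1)])
    with \<open>length vs = length vs'\<close> show ?thesis
      unfolding Z_def by (auto elim: in_set_impl_in_set_zip1)
  qed
  show "L.labelled_colors \<phi> (pverts T) \<subseteq> R.labelled_colors \<phi>' (pverts T')"
    using total Z bisim by (fastforce simp: L.labelled_colors_def R.labelled_colors_def)
  show "L.labelled_arcs \<phi> (pverts T) \<subseteq> R.labelled_arcs \<phi>' (pverts T')"
  proof (clarsimp simp: L.labelled_arcs_def)
    fix x y assume "(x, y) \<in> parcs T" "x \<in> pverts T"
    with total bisim obtain x' y' where "(x, x') \<in> Z" "(y, y') \<in> Z" "(x', y') \<in> parcs T'" by blast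
    with Z show "(\<phi> x, \<phi> y) \<in> R.labelled_arcs \<phi>' (pverts T')"
      unfolding R.labelled_arcs_def by (intro image_eqI[of _ _ "(x', y')"]) auto
  qed
qed

section \<open>Isomorphisms, labels and arrays\<close>

lemma labelled_eq_imp_iso:
  assumes inj: "inj_on \<phi> (pverts T)" "inj_on \<phi>' (pverts T')"
    and arcs: "L.labelled_arcs \<phi> (pverts T) = R.labelled_arcs \<phi>' (pverts T')"
    and colors: "L.labelled_colors \<phi> (pverts T) = R.labelled_colors \<phi>' (pverts T')"
  obtains f where "colored_iso T c T' c' f" "\<And>v. v \<in> pverts T \<Longrightarrow> \<phi>' (f v) = \<phi> v"
proof -
  \<comment> \<open>Each vertex is sent to the vertex of \<open>T'\<close> with the same
    label.\<close>
  define f where "f = the_inv_into (pverts T') \<phi>' \<circ> \<phi>"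
  have img: "\<phi> ` pverts T = \<phi>' ` pverts T'"
    using arg_cong[OF colors, of "image fst"]
    by (simp add: L.labelled_colors_def R.labelled_colors_def image_image)
  have f: "\<phi>' (f v) = \<phi> v" "f v \<in> pverts T'" if "v \<in> pverts T" for v
  proof -
    have v: "\<phi> v \<in> \<phi>' ` pverts T'" using that img by blast
    show "\<phi>' (f v) = \<phi> v" using f_the_inv_into_f[OF inj(2) v] by (simp add: f_def)
    show "f v \<in> pverts T'" using the_inv_into_into[OF inj(2) v subset_refl] by (simp add: f_def)
  qed
  have bij: "bij_betw f (pverts T) (pverts T')"
    unfolding f_def using inj(1) bij_betw_the_inv_into[OF inj_on_imp_bij_betw[OF inj(2)]]
    by (intro bij_betw_trans[of \<phi> _ "\<phi> ` pverts T"]) (simp_all add: img inj_on_imp_bij_betw flip: img)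
  have c: "c' (f v) = c v" if v: "v \<in> pverts T" for v
  proof -
    have "(\<phi> v, c v) \<in> R.labelled_colors \<phi>' (pverts T')"
      using v unfolding colors[symmetric] L.labelled_colors_def by blast
    then obtain w where "w \<in> pverts T'" "\<phi>' w = \<phi> v" "c' w = c v"
      by (auto simp: R.labelled_colors_def)
    with f[OF v] inj(2) show ?thesis by (metis inj_onD)
  qed
  have a: "(u, v) \<in> parcs T \<longleftrightarrow> (f u, f v) \<in> parcs T'" if uv: "u \<in> pverts T" "v \<in> pverts T" for u v
  proof -
    have "(u, v) \<in> parcs T \<longleftrightarrow> (\<phi> u, \<phi> v) \<in> L.labelled_arcs \<phi> (pverts T)"
      by (simp add: L.labelled_arcs_iff[OF inj(1) uv])
    also have "\<dots> \<longleftrightarrow> (\<phi>' (f u), \<phi>' (f v)) \<in> R.labelled_arcs \<phi>' (pverts T')"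
      using uv f by (simp add: arcs)
    also have "\<dots> \<longleftrightarrow> (f u, f v) \<in> parcs T'"
      by (rule R.labelled_arcs_iff[OF inj(2) f(2)[OF uv(1)] f(2)[OF uv(2)]])
    finally show ?thesis .
  qed
  show thesis using that[of f] bij a c f(1) unfolding colored_iso_def by blast
qed

text \<open>By induction \<open>f\<close> preserves the sorting keys of the children, so it maps a
  sorted list of children to a sorted one, and \<open>LDA_eq\<close> accepts any such list.\<close>

lemma LDA_iso:
  assumes f: "colored_iso T c T' c' f"
  shows "u \<in> pverts T \<Longrightarrow> L.LDA u = R.LDA (f u)"
proof (induction u rule: wf_induct_rule[OF L.wf_parcs_converse])
  case (1 u)
  have bij: "bij_betw f (pverts T) (pverts T')"
    and arcs: "\<And>u v. u \<in> pverts T \<Longrightarrow> v \<in> pverts T \<Longrightarrow> (u, v) \<in> parcs T \<longleftrightarrow> (f u, f v) \<in> parcs T'"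
    and c: "\<And>v. v \<in> pverts T \<Longrightarrow> c' (f v) = c v"
    using f unfolding colored_iso_def by blast+
  obtain ns where ns: "L.sorted_children u ns"
    using L.ex_sorted_children unfolding L.sorted_children_def by blast
  have sub: "set ns \<subseteq> pverts T"
    using ns by (auto simp: L.sorted_children_def children_def dest: L.in_arcsD2)
  have LDA: "L.LDA v = R.LDA (f v)" if "v \<in> set ns" for v
    using that 1 sub ns by (auto simp: L.sorted_children_def children_def)
  have "children T' (f u) = f ` children T u"
  proof (intro equalityI subsetI)
    fix w assume w: "w \<in> children T' (f u)"
    then have "w \<in> f ` pverts T"
      using bij by (auto simp: children_def bij_betw_def dest: R.in_arcsD2)
    then show "w \<in> f ` children T u" using w arcs 1(2) by (auto simp: children_def)
  next
    fix w assume "w \<in> f ` children T u"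
    then show "w \<in> children T' (f u)" using arcs 1(2) by (auto simp: children_def dest: L.in_arcsD2)
  qed
  moreover have "map (\<lambda>v. (c' v, R.LDA v)) (map f ns) = map (\<lambda>v. (c v, L.LDA v)) ns"
    using LDA c sub by auto
  moreover have "inj_on f (set ns)"
    using bij sub by (auto simp: bij_betw_def intro: inj_on_subset)
  ultimately have "R.sorted_children (f u) (map f ns)"
    using ns by (simp add: L.sorted_children_def R.sorted_children_def distinct_map del: map_map)
  from R.LDA_eq[OF this] show ?case
    using LDA c sub by (simp add: L.LDA_eq[OF ns] comp_def subset_eq cong: map_cong)
qed

text \<open>The root is the only vertex without an incoming arc.\<close>

lemma root_iso:
  assumes "colored_iso T c T' c' f"
  shows "f r = r'"
proof (rule ccontr)
  have bij: "bij_betw f (pverts T) (pverts T')"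
    using assms unfolding colored_iso_def by blast
  assume "f r \<noteq> r'"
  moreover have "f r \<in> pverts T'" using bij L.root by (auto simp: bij_betw_def)
  ultimately obtain w where w: "(w, f r) \<in> parcs T'" using R.ex_arc_to by blast
  then have "w \<in> f ` pverts T" using bij by (auto simp: bij_betw_def dest: R.in_arcsD1)
  then obtain x where "x \<in> pverts T" "w = f x" by blast
  with w assms L.root have "(x, r) \<in> parcs T" unfolding colored_iso_def by blast
  with L.no_arc_to_root show False by blast
qed

section \<open>Pruning under isomorphism, and decoding\<close>

text \<open>An isomorphism that preserves labels maps the smallest leaf to the smallest leaf and its
  parent to the parent, so both trees yield the same column and remain corresponding.\<close>

lemma prune_iso:
  assumes f: "colored_iso T c T' c' f"
    and inj: "inj_on \<phi> (pverts T)" "inj_on \<phi>' (pverts T')"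
    and \<phi>: "\<And>v. v \<in> pverts T \<Longrightarrow> \<phi>' (f v) = \<phi> v"
  shows "L.rooted S \<Longrightarrow> R.rooted (f ` S) \<Longrightarrow> card S = Suc k \<Longrightarrow>
    prune \<phi> c k (T \<restriction> S) = prune \<phi>' c' k (T' \<restriction> (f ` S))"
proof (induction k arbitrary: S)
  case (Suc k)
  have bij: "bij_betw f (pverts T) (pverts T')"
    and arcs: "\<And>u v. u \<in> pverts T \<Longrightarrow> v \<in> pverts T \<Longrightarrow> (u, v) \<in> parcs T \<longleftrightarrow> (f u, f v) \<in> parcs T'"
    and c: "\<And>v. v \<in> pverts T \<Longrightarrow> c' (f v) = c v"
    using f unfolding colored_iso_def by blast+
  have S: "S \<subseteq> pverts T" using Suc.prems(1) by (simp add: L.rooted_def)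
  have injf: "inj_on f S" using bij S by (auto simp: bij_betw_def intro: inj_on_subset)
  have card: "card (f ` S) = Suc (Suc k)" using injf Suc.prems(3) by (simp add: card_image)
  obtain u v where uv: "v \<in> L.leaves S" "v \<noteq> r" "(u, v) \<in> parcs T" "u \<in> S"
    "\<And>w. w \<in> L.leaves S \<Longrightarrow> \<phi> v \<le> \<phi> w"
    "prune \<phi> c (Suc k) (T \<restriction> S) = (Some (\<phi> u), c v) # prune \<phi> c k (T \<restriction> (S - {v}))"
    using L.prune_step[OF inj(1) Suc.prems(1,3)] by metis
  obtain u' v' where uv': "v' \<in> R.leaves (f ` S)" "v' \<noteq> r'" "(u', v') \<in> parcs T'" "u' \<in> f ` S"
    "\<And>w. w \<in> R.leaves (f ` S) \<Longrightarrow> \<phi>' v' \<le> \<phi>' w"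
    "prune \<phi>' c' (Suc k) (T' \<restriction> (f ` S)) =
      (Some (\<phi>' u'), c' v') # prune \<phi>' c' k (T' \<restriction> (f ` S - {v'}))"
    using R.prune_step[OF inj(2) Suc.prems(2) card] by metis
  have leaf_iff: "f w \<in> R.leaves (f ` S) \<longleftrightarrow> w \<in> L.leaves S" if "w \<in> S" for w
  proof -
    have "(w, x) \<in> parcs T \<longleftrightarrow> (f w, f x) \<in> parcs T'" if "x \<in> S" for x
      using arcs \<open>w \<in> S\<close> that S by blast
    then have "children T' (f w) \<inter> f ` S = f ` (children T w \<inter> S)" by (auto simp: children_def)
    with that show ?thesis by (simp add: L.leaves_def R.leaves_def)
  qed
  have "v \<in> S" using uv(1) by (simp add: L.leaves_def)
  obtain w where w: "w \<in> S" "v' = f w" using uv'(1) by (auto simp: R.leaves_def)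
  \<comment> \<open>Minimality is used on both sides: \<open>v'\<close> against the image of
    \<open>v\<close>, and \<open>v\<close> against the preimage \<open>w\<close> of
    \<open>v'\<close>.\<close>
  have "\<phi>' v' \<le> \<phi>' (f v)" using uv'(5) uv(1) leaf_iff \<open>v \<in> S\<close> by blast
  moreover have "\<phi> v \<le> \<phi> w" using uv(5) uv'(1) leaf_iff w by blast
  ultimately have "\<phi> w = \<phi> v" using w S \<phi> \<open>v \<in> S\<close> by (auto simp: subset_eq)
  then have "w = v" using inj(1) w(1) \<open>v \<in> S\<close> S by (auto dest: inj_onD)
  then have v': "v' = f v" using w by simp
  have "(f u, f v) \<in> parcs T'" using arcs uv(3,4) \<open>v \<in> S\<close> S by blast
  then have u': "u' = f u" using uv'(3) R.parent_unique v' by blast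
  have img: "f ` S - {v'} = f ` (S - {v})" using injf \<open>v \<in> S\<close> v' by (auto dest: inj_onD)
  have "L.rooted (S - {v})" using L.rooted_Diff Suc.prems(1) uv(1,2) by blast
  moreover have "R.rooted (f ` (S - {v}))"
    using R.rooted_Diff[OF Suc.prems(2) uv'(1,2)] by (simp only: img)
  moreover have "card (S - {v}) = Suc k" using \<open>v \<in> S\<close> Suc.prems(3) by simp
  ultimately have "prune \<phi> c k (T \<restriction> (S - {v})) = prune \<phi>' c' k (T' \<restriction> (f ` (S - {v})))"
    by (rule Suc.IH)
  moreover have "\<phi>' u' = \<phi> u" "c' v' = c v"
    using u' v' \<phi> c uv(4) \<open>v \<in> S\<close> S by (auto simp: subset_eq)
  ultimately show ?case unfolding uv(6) uv'(6) img by simp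
qed simp

text \<open>
  The leaves of the current tree carry exactly the labels that no remaining column records as a parent,
  so both codes remove the same label at every step.
\<close>

lemma prune_eq_imp_labelled_eq:
  assumes inj: "inj_on \<phi> (pverts T)" "inj_on \<phi>' (pverts T')" and c: "c r = c' r'"
  shows "L.rooted S \<Longrightarrow> R.rooted S' \<Longrightarrow> card S = Suc k \<Longrightarrow> card S' = Suc k \<Longrightarrow> \<phi> ` S = \<phi>' ` S' \<Longrightarrow>
    prune \<phi> c k (T \<restriction> S) = prune \<phi>' c' k (T' \<restriction> S') \<Longrightarrow>
    L.labelled_arcs \<phi> S = R.labelled_arcs \<phi>' S' \<and> L.labelled_colors \<phi> S = R.labelled_colors \<phi>' S'"
proof (induction k arbitrary: S S')
  case 0
  \<comment> \<open>Only the root is left. \<open>prune\<close> does not record its color, so the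
    hypothesis \<open>c\<close> supplies it.\<close>
  then have "S = {r}" "S' = {r'}"
    by (simp_all add: L.rooted_singleton R.rooted_singleton)
  with 0 c show ?case
    by (simp add: L.rooted_singleton R.rooted_singleton
        L.labelled_colors_def R.labelled_colors_def)
next
  case (Suc k)
  have sub: "S \<subseteq> pverts T" "S' \<subseteq> pverts T'"
    using Suc.prems(1,2) by (simp_all add: L.rooted_def R.rooted_def)
  obtain u v where uv: "v \<in> L.leaves S" "v \<noteq> r" "(u, v) \<in> parcs T" "u \<in> S"
    "\<And>w. w \<in> L.leaves S \<Longrightarrow> \<phi> v \<le> \<phi> w"
    "prune \<phi> c (Suc k) (T \<restriction> S) = (Some (\<phi> u), c v) # prune \<phi> c k (T \<restriction> (S - {v}))"
    using L.prune_step[OF inj(1) Suc.prems(1,3)] by metis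
  obtain u' v' where uv': "v' \<in> R.leaves S'" "v' \<noteq> r'" "(u', v') \<in> parcs T'" "u' \<in> S'"
    "\<And>w. w \<in> R.leaves S' \<Longrightarrow> \<phi>' v' \<le> \<phi>' w"
    "prune \<phi>' c' (Suc k) (T' \<restriction> S') = (Some (\<phi>' u'), c' v') # prune \<phi>' c' k (T' \<restriction> (S' - {v'}))"
    using R.prune_step[OF inj(2) Suc.prems(2,4)] by metis
  have v: "v \<in> S" "v' \<in> S'" using uv(1) uv'(1) by (simp_all add: L.leaves_def R.leaves_def)
  have "Some ` fst ` L.labelled_arcs \<phi> S = Some ` fst ` R.labelled_arcs \<phi>' S'"
    using L.fst_set_prune[OF inj(1) Suc.prems(1,3)] R.fst_set_prune[OF inj(2) Suc.prems(2,4)]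
    by (simp only: Suc.prems(6))
  then have "fst ` L.labelled_arcs \<phi> S = fst ` R.labelled_arcs \<phi>' S'"
    by (simp only: inj_image_eq_iff[OF inj_Some])
  then have leaves: "\<phi> ` L.leaves S = \<phi>' ` R.leaves S'"
    by (simp only: L.image_leaves[OF inj(1) Suc.prems(1)] R.image_leaves[OF inj(2) Suc.prems(2)]
        Suc.prems(5))
  \<comment> \<open>Both removed labels are the minimum of the same set of leaf labels.\<close>
  obtain w where "w \<in> L.leaves S" "\<phi>' v' = \<phi> w" using leaves uv'(1) by blast
  moreover obtain w' where "w' \<in> R.leaves S'" "\<phi> v = \<phi>' w'" using leaves uv(1) by blast
  ultimately have v_eq: "\<phi> v = \<phi>' v'" using uv(5) uv'(5) by (metis order_antisym)
  have eq: "\<phi> u = \<phi>' u'" "c v = c' v'"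
    "prune \<phi> c k (T \<restriction> (S - {v})) = prune \<phi>' c' k (T' \<restriction> (S' - {v'}))"
    using Suc.prems(6) unfolding uv(6) uv'(6) by simp_all
  have "\<phi> ` (S - {v}) = \<phi> ` S - {\<phi> v}" "\<phi>' ` (S' - {v'}) = \<phi>' ` S' - {\<phi>' v'}"
    using inj sub v by (auto dest: inj_onD)
  then have "\<phi> ` (S - {v}) = \<phi>' ` (S' - {v'})" using Suc.prems(5) v_eq by simp
  moreover have "card (S - {v}) = Suc k" "card (S' - {v'}) = Suc k"
    using v Suc.prems(3,4) by simp_all
  ultimately have "L.labelled_arcs \<phi> (S - {v}) = R.labelled_arcs \<phi>' (S' - {v'})"
    "L.labelled_colors \<phi> (S - {v}) = R.labelled_colors \<phi>' (S' - {v'})"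
    using Suc.IH[OF L.rooted_Diff[OF Suc.prems(1) uv(1,2)] R.rooted_Diff[OF Suc.prems(2) uv'(1,2)]]
      eq(3) by blast+
  then show ?case
    using eq v_eq v by (simp add: L.labelled_arcs_leaf[OF uv(1,3,4)]
        R.labelled_arcs_leaf[OF uv'(1,3,4)] L.labelled_colors_insert[of v]
        R.labelled_colors_insert[of v'])
qed

end

theorem theorem4p3:
  fixes T :: "'a pair_pre_digraph" and T' :: "'b pair_pre_digraph"
    and r :: 'a and r' :: 'b
    and c :: "'a \<Rightarrow> nat" and c' :: "'b \<Rightarrow> nat"
    and P P' :: "(nat option \<times> nat) list"
  assumes "colored_arborescence T r" and "colored_arborescence T' r'"
    and "colored_arborescence.is_vcpc T r c P"
    and "colored_arborescence.is_vcpc T' r' c' P'"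
  shows "(\<exists>f. colored_iso T c T' c' f) \<longleftrightarrow> P = P'"
proof -
  interpret L: colored_arborescence T r c by fact
  interpret R: colored_arborescence T' r' c' by fact
  interpret LR: colored_arborescence_pair T r c T' r' c' ..
  interpret RL: colored_arborescence_pair T' r' c' T r c ..
  obtain \<phi> where \<phi>: "L.dfs_numbering \<phi>"
    and P: "P = prune \<phi> c (card (pverts T) - 1) T @ [(None, c r)]"
    using assms(3) unfolding L.is_vcpc_def by blast
  obtain \<phi>' where \<phi>': "R.dfs_numbering \<phi>'"
    and P': "P' = prune \<phi>' c' (card (pverts T') - 1) T' @ [(None, c' r')]"
    using assms(4) unfolding R.is_vcpc_def by blast
  note bij = L.bij_betw_dfs_numbering[OF \<phi>] R.bij_betw_dfs_numbering[OF \<phi>']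
  note inj = bij[THEN bij_betw_imp_inj_on]
  define k k' where "k = card (pverts T) - 1" and "k' = card (pverts T') - 1"
  \<comment> \<open>Nonempty vertex sets make the truncated subtraction in \<open>k\<close> and
    \<open>k'\<close> exact.\<close>
  have "card (pverts T) \<noteq> 0" "card (pverts T') \<noteq> 0"
    using L.root R.root L.pair_finite_verts R.pair_finite_verts by auto
  then have card: "card (pverts T) = Suc k" "card (pverts T') = Suc k'"
    unfolding k_def k'_def by arith+
  have T: "T \<restriction> pverts T = T" "T' \<restriction> pverts T' = T'"
    by (simp_all add: L.induce_subgraph_verts_eq R.induce_subgraph_verts_eq)
  show ?thesis
  proof
    assume "\<exists>f. colored_iso T c T' c' f"
    then obtain f where f: "colored_iso T c T' c' f" ..
    have LDA: "L.LDA r = R.LDA r'" and c: "c r = c' r'"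
      using LR.LDA_iso[OF f L.root] LR.root_iso[OF f] f L.root by (auto simp: colored_iso_def)
    \<comment> \<open>The given \<open>f\<close> need not respect the numberings, which may break
      ties differently. It only serves to equate the arrays and root colors; these yield an
      isomorphism \<open>g\<close> that does respect them.\<close>
    obtain g where g: "colored_iso T c T' c' g" "\<And>v. v \<in> pverts T \<Longrightarrow> \<phi>' (g v) = \<phi> v"
      using LR.labelled_eq_imp_iso[OF inj] LR.LDA_eq_labelled_subset[OF \<phi> \<phi>' LDA c]
        RL.LDA_eq_labelled_subset[OF \<phi>' \<phi> LDA[symmetric] c[symmetric]] by (metis subset_antisym)
    have "bij_betw g (pverts T) (pverts T')" using g(1) by (simp add: colored_iso_def)
    then have "g ` pverts T = pverts T'" "k' = k"
      by (simp_all add: bij_betw_imp_surj_on bij_betw_same_card k_def k'_def)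
    then show "P = P'"
      using LR.prune_iso[OF g(1) inj g(2) L.rooted_pverts _ card(1)] R.rooted_pverts c
      unfolding P P' k_def[symmetric] k'_def[symmetric] by (simp add: T)
  next
    assume eq: "P = P'"
    then have "length P = length P'" by simp
    then have "k' = k" unfolding P P' by (simp add: length_prune k_def k'_def)
    then have card': "card (pverts T') = Suc k" using card(2) by simp
    \<comment> \<open>Codes of equal length come from equally many vertices, and both label sets are
      the initial segment of that size.\<close>
    have img: "\<phi> ` pverts T = \<phi>' ` pverts T'"
      by (simp only: bij[THEN bij_betw_imp_surj_on] card(1) card')
    \<comment> \<open>The last column yields the root colors, the others the pruning
      sequences.\<close>
    have prune: "prune \<phi> c k (T \<restriction> pverts T) = prune \<phi>' c' k (T' \<restriction> pverts T')" and c: "c r = c' r'"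
      using eq \<open>k' = k\<close> unfolding P P' T k_def[symmetric] k'_def[symmetric] by simp_all
    note labelled = LR.prune_eq_imp_labelled_eq[OF inj c L.rooted_pverts R.rooted_pverts card(1) card' img prune]
    show "\<exists>f. colored_iso T c T' c' f"
      by (rule LR.labelled_eq_imp_iso[OF inj conjunct1[OF labelled] conjunct2[OF labelled]]) (rule exI)
  qed
qed

end
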